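(* Let $\alpha$ and $\beta$ be fixed partitions and $n,m$ fixed nonnegative integers. Then $$(-1)^{v(\alpha)+v(\beta)}\sum_{\substack{\lambda:\ \lambda/\alpha\vdash m\\ \lambda/\beta\vdash n}}(-1)^{v(\lambda)}I_{\lambda/\alpha}I_{\lambda/\beta}=(-1)^{mn}\sum_{\substack{\mu:\ \beta/\mu\vdash m\\ \alpha/\mu\vdash n}}(-1)^{v(\mu)}I_{\beta/\mu}I_{\alpha/\mu}+\frac{1-(-1)^{mn}}{2}\sum_{\substack{\mu:\ \beta/\mu\vdash m-1\\ \alpha/\mu\vdash n-1}}(-1)^{v(\mu)}I_{\beta/\mu}I_{\alpha/\mu}.$$
   Context: Partitions are identified with Young diagrams (cell $(i,j)$: row $i$, column $j$); for $\mu\subseteq\lambda$, $\lambda/\mu$ is the set of cells of $\lambda$ not in $\mu$ and $\lambda/\mu\vdash n$ means $\mu\subseteq\lambda$ and it has $n$ cells. $v(\lambda)$ is the number of cells of $\lambda$ in even-numbered rows. A standard Young tableau (SYT) of shape $\lambda/\mu\vdash n$ is a bijection $T$ from its cells to $[n]$ with $T(i,j)\le T(i',j')$ whenever $i\le i'$, $j\le j'$. Write $(i,j)\lhd(i',j')$ if $i<i'$ or ($i=i'$, $j<j'$). For $T$ of straight shape, ${\rm sign}(T)=(-1)^{\#\{(a,b):a\lhd b,\,T(a)>T(b)\}}$. For $T_1$ of shape $\nu/\mu\vdash k$ and $T_2$ of shape $\lambda/\nu$, $T_1\diamond T_2$ equals $T_1$ on $\nu/\mu$ and $T_2+k$ on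 $\lambda/\nu$. For $T$ of shape $\lambda/\mu$, ${\rm sign}(T)={\rm sign}(T_0){\rm sign}(T_0\diamond T)$ for any SYT $T_0$ of shape $\mu$ (independent of $T_0$), and $I_{\lambda/\mu}=\sum_T{\rm sign}(T)$ over SYTs of shape $\lambda/\mu$. *)

theory Defs
  imports Complex_Main "HOL-Library.FuncSet"
begin

definition is_partition :: "nat list \<Rightarrow> bool" where
  "is_partition p \<longleftrightarrow> sorted_wrt (\<ge>) p \<and> 0 \<notin> set p"

type_synonym cell = "nat \<times> nat"

text \<open>Rows and columns are numbered from 1, whereas list positions start at 0.\<close>

definition cells :: "nat list \<Rightarrow> cell set" where
  "cells p = {(i, j). 1 \<le> i \<and> i \<le> length p \<and> 1 \<le> j \<and> j \<le> p ! (i - 1)}"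

definition skew :: "nat list \<Rightarrow> nat list \<Rightarrow> cell set" where
  "skew \<kappa> \<mu> = cells \<kappa> - cells \<mu>"

text \<open>
  \<open>skew_of_size \<kappa> \<mu> k\<close> renders $\kappa/\mu \vdash k$. The size is an integer so that
  a size $m - 1$ is unattainable for $m = 0$.
\<close>

definition skew_of_size :: "nat list \<Rightarrow> nat list \<Rightarrow> int \<Rightarrow> bool" where
  "skew_of_size \<kappa> \<mu> k \<longleftrightarrow> cells \<mu> \<subseteq> cells \<kappa> \<and> int (card (skew \<kappa> \<mu>)) = k"

definition v :: "nat list \<Rightarrow> nat" where
  "v \<kappa> = card {(i, j) \<in> cells \<kappa>. even i}"

text \<open>
  A tableau is a function on cells with the value \<^term>\<open>undefined\<close> outside its shape, so that
  distinct elements of \<open>SYT \<kappa> \<mu>\<close> differ on the shape.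
\<close>

definition SYT :: "nat list \<Rightarrow> nat list \<Rightarrow> (cell \<Rightarrow> nat) set" where
  "SYT \<kappa> \<mu> = {T \<in> extensional (skew \<kappa> \<mu>).
     bij_betw T (skew \<kappa> \<mu>) {1..card (skew \<kappa> \<mu>)} \<and>
     (\<forall>i j i' j'. (i, j) \<in> skew \<kappa> \<mu> \<and> (i', j') \<in> skew \<kappa> \<mu> \<and> i \<le> i' \<and> j \<le> j'
        \<longrightarrow> T (i, j) \<le> T (i', j'))}"

definition cell_before :: "cell \<Rightarrow> cell \<Rightarrow> bool" (infix "\<lhd>\<^sub>c" 50) where
  "a \<lhd>\<^sub>c b \<longleftrightarrow> fst a < fst b \<or> (fst a = fst b \<and> snd a < snd b)"

definition sign_straight :: "nat list \<Rightarrow> (cell \<Rightarrow> nat) \<Rightarrow> int" where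
  "sign_straight \<kappa> T =
     (-1) ^ card {(a, b). a \<in> cells \<kappa> \<and> b \<in> cells \<kappa> \<and> a \<lhd>\<^sub>c b \<and> T a > T b}"

text \<open>\<open>diamond \<kappa> \<nu> \<mu> T\<^sub>1 T\<^sub>2\<close> is $T_1 \diamond T_2$ for $T_1$ of shape $\nu/\mu$
  and $T_2$ of shape $\kappa/\nu$.\<close>

definition diamond ::
  "nat list \<Rightarrow> nat list \<Rightarrow> nat list \<Rightarrow> (cell \<Rightarrow> nat) \<Rightarrow> (cell \<Rightarrow> nat) \<Rightarrow> cell \<Rightarrow> nat" where
  "diamond \<kappa> \<nu> \<mu> T\<^sub>1 T\<^sub>2 =
     restrict (\<lambda>c. if c \<in> skew \<nu> \<mu> then T\<^sub>1 c else T\<^sub>2 c + card (skew \<nu> \<mu>)) (skew \<kappa> \<mu>)"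

text \<open>
  The choice of \<open>T\<^sub>0\<close> is immaterial and a choice exists; see \<open>sign_skew_eq\<close> and
  \<open>SYT_straight_nonempty\<close> below.
\<close>

definition sign_skew :: "nat list \<Rightarrow> nat list \<Rightarrow> (cell \<Rightarrow> nat) \<Rightarrow> int" where
  "sign_skew \<kappa> \<mu> T =
     (let T\<^sub>0 = (SOME T\<^sub>0. T\<^sub>0 \<in> SYT \<mu> [])
      in sign_straight \<mu> T\<^sub>0 * sign_straight \<kappa> (diamond \<kappa> \<mu> [] T\<^sub>0 T))"

definition imbalance :: "nat list \<Rightarrow> nat list \<Rightarrow> int" where
  "imbalance \<kappa> \<mu> = (\<Sum>T \<in> SYT \<kappa> \<mu>. sign_skew \<kappa> \<mu> T)"

lemma cells_Nil [simp]: "cells [] = {}"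
  by (auto simp: cells_def)

lemma skew_Nil [simp]: "skew \<kappa> [] = cells \<kappa>"
  by (simp add: skew_def)

lemma cells_snoc: "cells (p @ [r]) = cells p \<union> {Suc (length p)} \<times> {1..r}"
  by (auto simp: cells_def nth_append split: if_splits)

lemma cells_row_le: "(i, j) \<in> cells p \<Longrightarrow> i \<le> length p"
  by (simp add: cells_def)

lemma finite_cells [simp]: "finite (cells p)"
  by (induction p rule: rev_induct) (simp_all add: cells_snoc)

lemma finite_skew [simp]: "finite (skew \<kappa> \<mu>)"
  by (simp add: skew_def)

lemma finite_SYT: "finite (SYT \<kappa> \<mu>)"
proof (rule finite_subset)
  show "SYT \<kappa> \<mu> \<subseteq> skew \<kappa> \<mu> \<rightarrow>\<^sub>E {1..card (skew \<kappa> \<mu>)}"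
    by (auto simp: SYT_def PiE_def bij_betw_def)
qed (simp add: finite_PiE)

lemma card_cells: "card (cells p) = sum_list p"
proof (induction p rule: rev_induct)
  case (snoc r p)
  have "cells p \<inter> {Suc (length p)} \<times> {1..r} = {}"
    by (auto dest: cells_row_le)
  then show ?case
    using snoc by (simp add: cells_snoc card_Un_disjoint card_cartesian_product)
qed simp

lemma finite_partitions_skew_of_size:
  "finite {\<kappa>. is_partition \<kappa> \<and> skew_of_size \<kappa> \<alpha> k}"
proof (rule finite_subset)
  let ?N = "sum_list \<alpha> + nat k"
  show "{\<kappa>. is_partition \<kappa> \<and> skew_of_size \<kappa> \<alpha> k}
      \<subseteq> {xs. set xs \<subseteq> {..?N} \<and> length xs \<le> ?N}"
  proof safe
    fix p assume p: "is_partition p" "skew_of_size p \<alpha> k"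
    have "card (skew p \<alpha>) = sum_list p - sum_list \<alpha>"
      using p(2) by (simp add: skew_def skew_of_size_def card_Diff_subset card_cells)
    then have N: "sum_list p \<le> ?N"
      using p(2) by (auto simp: skew_of_size_def)
    show "x \<le> ?N" if "x \<in> set p" for x
      using member_le_sum_list[OF that] N by linarith
    have "length q \<le> sum_list q" if "0 \<notin> set q" for q :: "nat list"
      using that by (induction q) auto
    then show "length p \<le> ?N"
      using p(1) N le_trans unfolding is_partition_def by blast
  qed
qed (use finite_lists_length_le in auto)

lemma finite_partitions_contained:
  "finite {\<mu>. is_partition \<mu> \<and> skew_of_size \<alpha> \<mu> k}"
proof (rule finite_subset)
  let ?N = "sum_list \<alpha>"
  show "{\<mu>. is_partition \<mu> \<and> skew_of_size \<alpha> \<mu> k}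
      \<subseteq> {xs. set xs \<subseteq> {..?N} \<and> length xs \<le> ?N}"
  proof safe
    fix p assume p: "is_partition p" "skew_of_size \<alpha> p k"
    have N: "sum_list p \<le> ?N"
      using p(2) by (metis card_cells card_mono finite_cells skew_of_size_def)
    show "x \<le> ?N" if "x \<in> set p" for x
      using member_le_sum_list[OF that] N by linarith
    have "length q \<le> sum_list q" if "0 \<notin> set q" for q :: "nat list"
      using that by (induction q) auto
    then show "length p \<le> ?N"
      using p(1) N le_trans unfolding is_partition_def by blast
  qed
qed (use finite_lists_length_le in auto)

lemma SYT_straight_nonempty: "SYT p [] \<noteq> {}"
proof -
  have "\<exists>T. bij_betw T (cells p) {1..card (cells p)} \<and>
     (\<forall>i j i' j'. (i, j) \<in> cells p \<and> (i', j') \<in> cells p \<and> i \<le> i' \<and> j \<le> j'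
        \<longrightarrow> T (i, j) \<le> T (i', j'))" for p
  proof (induction p rule: rev_induct)
    case (snoc r p)
    then obtain T where b: "bij_betw T (cells p) {1..card (cells p)}"
      and m: "\<And>i j i' j'. (i, j) \<in> cells p \<Longrightarrow> (i', j') \<in> cells p \<Longrightarrow> i \<le> i' \<Longrightarrow> j \<le> j'
        \<Longrightarrow> T (i, j) \<le> T (i', j')"
      by blast
    let ?N = "card (cells p)" and ?l = "Suc (length p)"
    define T' where "T' c = (if c \<in> cells p then T c else ?N + snd c)" for c :: cell
    have out: "(?l, j) \<notin> cells p" for j by (auto dest: cells_row_le)
    have card: "card (cells (p @ [r])) = ?N + r" by (simp add: card_cells)
    have "bij_betw T' (cells p) {1..?N}"
      using b by (rule bij_betw_cong[THEN iffD1, rotated]) (simp add: T'_def)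
    moreover have "bij_betw T' ({?l} \<times> {1..r}) {?N+1..?N+r}"
      by (rule bij_betwI[where g = "\<lambda>x. (?l, x - ?N)"]) (auto simp: T'_def out)
    ultimately have "bij_betw T' (cells p \<union> {?l} \<times> {1..r}) ({1..?N} \<union> {?N+1..?N+r})"
      by (rule bij_betw_combine) auto
    moreover have "{1..?N} \<union> {?N+1..?N+r} = {1..?N + r}" by auto
    ultimately have b': "bij_betw T' (cells (p @ [r])) {1..card (cells (p @ [r]))}"
      unfolding card by (simp add: cells_snoc)
    have Tle: "T c \<le> ?N" if "c \<in> cells p" for c
      using b that by (auto simp: bij_betw_def)
    have "T' (i, j) \<le> T' (i', j')"
      if "(i, j) \<in> cells (p @ [r])" "(i', j') \<in> cells (p @ [r])" "i \<le> i'" "j \<le> j'" for i j i' j'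
      using that m[of i j i' j'] Tle[of "(i, j)"] cells_row_le[of i' j' p]
      by (auto simp: cells_snoc T'_def out)
    with b' show ?case by blast
  qed (simp add: bij_betw_def)
  then obtain T where T: "bij_betw T (cells p) {1..card (cells p)}"
     "\<forall>i j i' j'. (i, j) \<in> cells p \<and> (i', j') \<in> cells p \<and> i \<le> i' \<and> j \<le> j'
        \<longrightarrow> T (i, j) \<le> T (i', j')"
    by blast
  have "bij_betw (restrict T (cells p)) (cells p) {1..card (cells p)}"
    using T(1) by (rule bij_betw_cong[THEN iffD1, rotated]) simp
  then have "restrict T (cells p) \<in> SYT p []"
    using T(2) by (simp add: SYT_def)
  then show ?thesis by blast
qed

lemma sign_straight_diamond:
  assumes sub: "cells \<mu> \<subseteq> cells \<kappa>" and T: "T \<in> SYT \<kappa> \<mu>" and T0: "T\<^sub>0 \<in> SYT \<mu> []"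
  shows "sign_straight \<mu> T\<^sub>0 * sign_straight \<kappa> (diamond \<kappa> \<mu> [] T\<^sub>0 T) =
    (-1) ^ (card {(a, b). a \<in> skew \<kappa> \<mu> \<and> b \<in> skew \<kappa> \<mu> \<and> a \<lhd>\<^sub>c b \<and> T a > T b} +
            card {(a, b). a \<in> skew \<kappa> \<mu> \<and> b \<in> cells \<mu> \<and> a \<lhd>\<^sub>c b})"
proof -
  let ?D = "diamond \<kappa> \<mu> [] T\<^sub>0 T"
  let ?A = "{(a, b). a \<in> cells \<mu> \<and> b \<in> cells \<mu> \<and> a \<lhd>\<^sub>c b \<and> T\<^sub>0 a > T\<^sub>0 b}"
  let ?B = "{(a, b). a \<in> skew \<kappa> \<mu> \<and> b \<in> skew \<kappa> \<mu> \<and> a \<lhd>\<^sub>c b \<and> T a > T b}"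
  let ?C = "{(a, b). a \<in> skew \<kappa> \<mu> \<and> b \<in> cells \<mu> \<and> a \<lhd>\<^sub>c b}"
  let ?E = "{(a, b). a \<in> cells \<kappa> \<and> b \<in> cells \<kappa> \<and> a \<lhd>\<^sub>c b \<and> ?D a > ?D b}"
  have in0: "?D c = T\<^sub>0 c" if "c \<in> cells \<mu>" for c
    using that sub by (auto simp: diamond_def)
  have in1: "?D c = T c + card (cells \<mu>)" if "c \<in> skew \<kappa> \<mu>" for c
    using that by (auto simp: diamond_def skew_def)
  have le0: "T\<^sub>0 c \<le> card (cells \<mu>)" if "c \<in> cells \<mu>" for c
    using T0 that by (auto simp: SYT_def bij_betw_def)
  have pos: "T c \<ge> 1" if "c \<in> skew \<kappa> \<mu>" for c
    using T that by (auto simp: SYT_def bij_betw_def)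
  have cross: "?D a < ?D b" if "a \<in> cells \<mu>" "b \<in> skew \<kappa> \<mu>" for a b
    using in0[OF that(1)] in1[OF that(2)] le0[OF that(1)] pos[OF that(2)] by linarith
  have E: "?E = ?A \<union> (?B \<union> ?C)"
  proof (intro set_eqI, clarify)
    fix a b
    show "(a, b) \<in> ?E \<longleftrightarrow> (a, b) \<in> ?A \<union> (?B \<union> ?C)"
      using sub cross[of a b] cross[of b a] in0[of a] in0[of b] in1[of a] in1[of b]
      by (cases "a \<in> cells \<mu>"; cases "b \<in> cells \<mu>") (auto simp: skew_def)
  qed
  have fin: "finite ?A" "finite ?B" "finite ?C"
    by (rule finite_subset[of _ "cells \<kappa> \<times> cells \<kappa>"]; use sub in \<open>auto simp: skew_def\<close>)+
  have "card ?E = card ?A + (card ?B + card ?C)"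
    unfolding E using fin by (subst card_Un_disjoint; (subst card_Un_disjoint)?) (auto simp: skew_def)
  then show ?thesis
    by (simp add: sign_straight_def power_add flip: mult.assoc power_mult_distrib)
qed

lemma sign_skew_eq:
  assumes "cells \<mu> \<subseteq> cells \<kappa>" "T \<in> SYT \<kappa> \<mu>" "T\<^sub>0 \<in> SYT \<mu> []"
  shows "sign_skew \<kappa> \<mu> T = sign_straight \<mu> T\<^sub>0 * sign_straight \<kappa> (diamond \<kappa> \<mu> [] T\<^sub>0 T)"
proof -
  have "(SOME T\<^sub>0. T\<^sub>0 \<in> SYT \<mu> []) \<in> SYT \<mu> []"
    using assms(3) by (metis someI_ex)
  then show ?thesis
    using assms by (simp add: sign_skew_def Let_def sign_straight_diamond)
qed

end

theory Submission
  imports Defs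
begin

text \<open>
  Building a tableau cell by cell, adding a cell \<open>c\<close> to a diagram \<open>K\<close> multiplies the sign by
  \<open>(-1)^b\<close>, where \<open>b\<close> is the number of cells of \<open>K\<close> after \<open>c\<close>. Hence imbalances are the
  matrix entries of the powers of a signed up operator \<open>U\<close>; let \<open>D\<close> be its transpose
  conjugated by \<open>(-1)^v\<close>. Two cells added or removed in opposite orders give opposite signs, so the
  off-diagonal part of \<open>D U + U D\<close> vanishes, while its diagonal entries telescope along the rows to
  \<open>1\<close>. Thus \<open>D U + U D = 1\<close>, whence \<open>D\<^sup>2\<close> commutes with \<open>U\<close>, \<open>D\<close> commutes with \<open>U\<^sup>2\<close>, and
  comparing matrix entries of \<open>D\<^sup>m U\<^sup>n\<close> and \<open>U\<^sup>n D\<^sup>m\<close> gives the theorem.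
\<close>

section \<open>Young diagrams as sets of cells\<close>

text \<open>Diagrams are kept as sets of cells, not as lists: adding or removing a cell is then
  \<open>insert\<close> or set difference, and unions and intersections of diagrams are again
  diagrams.\<close>

definition young :: "cell set \<Rightarrow> bool" where
  "young K \<longleftrightarrow> finite K \<and> (\<forall>i j. (i, j) \<in> K \<longrightarrow> 1 \<le> i \<and> 1 \<le> j) \<and>
     (\<forall>i j i' j'. (i, j) \<in> K \<longrightarrow> 1 \<le> i' \<longrightarrow> i' \<le> i \<longrightarrow> 1 \<le> j' \<longrightarrow> j' \<le> j \<longrightarrow> (i', j') \<in> K)"

definition removable :: "cell set \<Rightarrow> cell set" where
  "removable K = {c \<in> K. young (K - {c})}"

definition addable :: "cell set \<Rightarrow> cell set" where
  "addable K = {c. c \<notin> K \<and> young (insert c K)}"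

definition row_sign :: "cell \<Rightarrow> int" where
  "row_sign c = (if even (fst c) then - 1 else 1)"

text \<open>Only cells strictly after \<open>c\<close> count, so the value is the same whether or
  not \<open>c\<close> lies in \<open>K\<close>; it serves both for adding and for removing
  \<open>c\<close>.\<close>

definition after_sign :: "cell set \<Rightarrow> cell \<Rightarrow> int" where
  "after_sign K c = (-1) ^ card {b \<in> K. c \<lhd>\<^sub>c b}"

definition even_rows :: "cell set \<Rightarrow> nat" where
  "even_rows K = card {(i, j) \<in> K. even i}"

definition row_length :: "cell set \<Rightarrow> nat \<Rightarrow> nat" where
  "row_length K i = card {j. (i, j) \<in> K}"

lemma young_finite: "young K \<Longrightarrow> finite K"
  by (simp add: young_def)

lemma young_pos: "young K \<Longrightarrow> (i, j) \<in> K \<Longrightarrow> 1 \<le> i \<and> 1 \<le> j"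
  unfolding young_def by blast

lemma young_down:
  "young K \<Longrightarrow> (i, j) \<in> K \<Longrightarrow> 1 \<le> i' \<Longrightarrow> i' \<le> i \<Longrightarrow> 1 \<le> j' \<Longrightarrow> j' \<le> j \<Longrightarrow> (i', j') \<in> K"
  unfolding young_def by blast

lemma young_Int: "young K \<Longrightarrow> young L \<Longrightarrow> young (K \<inter> L)"
  unfolding young_def by blast

lemma young_Un: "young K \<Longrightarrow> young L \<Longrightarrow> young (K \<union> L)"
  unfolding young_def by blast

lemma finite_removable: "young K \<Longrightarrow> finite (removable K)"
  by (rule finite_subset[of _ K]) (auto simp: removable_def young_finite)

lemma finite_Collect_row: "young K \<Longrightarrow> finite {j. (i, j) \<in> K}"
  by (rule finite_subset[of _ "snd ` K"]) (force simp: young_finite)+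

text \<open>A row is closed to the left, so it is an initial segment determined by its number of
  cells.\<close>

lemma mem_young_iff:
  assumes "young K"
  shows "(i, j) \<in> K \<longleftrightarrow> 1 \<le> i \<and> 1 \<le> j \<and> j \<le> row_length K i"
proof -
  let ?R = "{j. (i, j) \<in> K}"
  have fin: "finite ?R" using assms by (rule finite_Collect_row)
  show ?thesis
  proof
    assume ij: "(i, j) \<in> K"
    then have "{1..j} \<subseteq> ?R"
      using assms young_down[OF assms ij] young_pos[OF assms ij] by auto
    then have "j \<le> card ?R" using card_mono[OF fin, of "{1..j}"] by simp
    then show "1 \<le> i \<and> 1 \<le> j \<and> j \<le> row_length K i"
      using young_pos[OF assms ij] by (simp add: row_length_def)
  next
    assume j: "1 \<le> i \<and> 1 \<le> j \<and> j \<le> row_length K i"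
    show "(i, j) \<in> K"
    proof (rule ccontr)
      assume nin: "(i, j) \<notin> K"
      have "?R \<subseteq> {1..j-1}"
      proof
        fix k assume "k \<in> ?R"
        then have k: "(i, k) \<in> K" by simp
        then have "1 \<le> k" "\<not> j \<le> k"
          using young_pos[OF assms k] young_down[OF assms k, of i j] j nin by auto
        then show "k \<in> {1..j-1}" by auto
      qed
      then have "card ?R \<le> j - 1" using card_mono[of "{1..j-1}" ?R] by simp
      with j show False unfolding row_length_def by linarith
    qed
  qed
qed

lemma row_length_antimono:
  assumes "young K" "1 \<le> i" "i \<le> i'"
  shows "row_length K i' \<le> row_length K i"
  unfolding row_length_def
proof (rule card_mono[OF finite_Collect_row[OF assms(1)]], safe)
  fix j assume "(i', j) \<in> K"
  then show "(i, j) \<in> K" using young_down[OF assms(1)] young_pos[OF assms(1)] assms(2,3) by blast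
qed

text \<open>Adding or removing one cell changes a single row length. With a function update for
  \<open>r\<close>, being a diagram reduces to comparing neighbouring rows.\<close>

lemma youngI_row_length:
  assumes "finite K" "\<And>i j. (i, j) \<in> K \<longleftrightarrow> 1 \<le> i \<and> 1 \<le> j \<and> j \<le> r i"
    "\<And>i. 1 \<le> i \<Longrightarrow> r (Suc i) \<le> r i"
  shows "young K"
proof -
  have anti: "r i' \<le> r i" if "1 \<le> i" "i \<le> i'" for i i'
    using that(2) by (induction rule: dec_induct) (use that(1) assms(3) in \<open>auto intro: order_trans\<close>)
  show ?thesis
    unfolding young_def assms(2) using assms(1) anti by (meson le_trans)
qed

text \<open>The first row is a separate case because row 0 is empty: for \<open>i = 1\<close> the
  comparison with \<open>row_length K 0 = 0\<close> would fail.\<close>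

lemma addable_iff:
  assumes "young K"
  shows "(i, j) \<in> addable K \<longleftrightarrow>
    1 \<le> i \<and> j = Suc (row_length K i) \<and> (i = 1 \<or> row_length K i < row_length K (i - 1))"
    (is "_ \<longleftrightarrow> ?R")
proof
  assume "(i, j) \<in> addable K"
  then have y: "young (insert (i, j) K)" and nin: "(i, j) \<notin> K"
    by (auto simp: addable_def)
  have pos: "1 \<le> i" "1 \<le> j" using young_pos[OF y] by auto
  have gt: "row_length K i < j" using nin pos mem_young_iff[OF assms] by auto
  have "(i, k) \<in> K" if "1 \<le> k" "k < j" for k
    using young_down[OF y, of i j i k] that pos by auto
  then have "\<not> Suc (row_length K i) < j"
    using mem_young_iff[OF assms, of i "Suc (row_length K i)"] by force
  then have j: "j = Suc (row_length K i)" using gt by simp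
  have "row_length K i < row_length K (i - 1)" if "i \<noteq> 1"
  proof -
    have "(i - 1, j) \<in> insert (i, j) K"
      using young_down[OF y, of i j "i - 1" j] that pos by auto
    then show ?thesis using that pos j mem_young_iff[OF assms] by auto
  qed
  then show ?R using pos j by blast
next
  assume R: ?R
  let ?r = "(row_length K)(i := j)"
  have "young (insert (i, j) K)"
  proof (rule youngI_row_length[of _ ?r])
    fix a b
    show "(a, b) \<in> insert (i, j) K \<longleftrightarrow> 1 \<le> a \<and> 1 \<le> b \<and> b \<le> ?r a"
      using R mem_young_iff[OF assms] by auto
    show "?r (Suc a) \<le> ?r a" if "1 \<le> a"
      using R that row_length_antimono[OF assms, of a "Suc a"] by auto
  qed (simp add: assms young_finite)
  then show "(i, j) \<in> addable K"
    using R mem_young_iff[OF assms] by (auto simp: addable_def)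
qed

lemma removable_iff:
  assumes "young K"
  shows "(i, j) \<in> removable K \<longleftrightarrow>
    1 \<le> i \<and> j = row_length K i \<and> row_length K (Suc i) < row_length K i"
    (is "_ \<longleftrightarrow> ?R")
proof
  assume "(i, j) \<in> removable K"
  then have y: "young (K - {(i, j)})" and mem: "(i, j) \<in> K"
    by (auto simp: removable_def)
  have pos: "1 \<le> i" "1 \<le> j" and le: "j \<le> row_length K i"
    using mem mem_young_iff[OF assms] by auto
  have "(i, Suc j) \<notin> K" "(Suc i, j) \<notin> K"
    using young_down[OF y, of i "Suc j" i j] young_down[OF y, of "Suc i" j i j] pos by auto
  then show ?R using pos le mem_young_iff[OF assms] by auto
next
  assume R: ?R
  let ?r = "(row_length K)(i := j - 1)"
  have "young (K - {(i, j)})"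
  proof (rule youngI_row_length[of _ ?r])
    fix a b
    show "(a, b) \<in> K - {(i, j)} \<longleftrightarrow> 1 \<le> a \<and> 1 \<le> b \<and> b \<le> ?r a"
      using R mem_young_iff[OF assms] by auto
    show "?r (Suc a) \<le> ?r a" if "1 \<le> a"
      using R that row_length_antimono[OF assms, of a "Suc a"] by auto
  qed (simp add: assms young_finite)
  then show "(i, j) \<in> removable K"
    using R mem_young_iff[OF assms] by (auto simp: removable_def)
qed

lemma row_length_eventually_0:
  assumes "young K"
  obtains N where "\<And>i. N < i \<Longrightarrow> row_length K i = 0"
proof
  \<comment> \<open>The inserted \<open>0\<close> keeps \<open>Max\<close> meaningful for the empty
    diagram.\<close>
  fix i assume i: "Max (insert 0 (fst ` K)) < i"
  then have "(i, j) \<notin> K" for j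
    using young_finite[OF assms] by force
  then show "row_length K i = 0" by (simp add: row_length_def)
qed

text \<open>The range ends at \<open>Suc N\<close> since a cell may be added in the empty row
  directly below a nonempty row \<open>N\<close>.\<close>

lemma addable_eq_image:
  assumes "young K" "\<And>i. N < i \<Longrightarrow> row_length K i = 0"
  shows "addable K = (\<lambda>i. (i, Suc (row_length K i))) `
    {i \<in> {1..Suc N}. i = 1 \<or> row_length K i < row_length K (i - 1)}"
proof -
  have "i \<le> Suc N" if "i = 1 \<or> row_length K i < row_length K (i - 1)" for i
    using that assms(2)[of "i - 1"] by (cases "N < i - 1") auto
  then show ?thesis using addable_iff[OF assms(1)] by auto
qed

lemma removable_eq_image:
  assumes "young K" "\<And>i. N < i \<Longrightarrow> row_length K i = 0"
  shows "removable K = (\<lambda>i. (i, row_length K i)) `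
    {i \<in> {1..N}. row_length K (Suc i) < row_length K i}"
proof -
  have "i \<le> N" if "row_length K (Suc i) < row_length K i" for i
    using that assms(2)[of i] by (cases "N < i") auto
  then show ?thesis using removable_iff[OF assms(1)] by auto
qed

lemma finite_addable:
  assumes "young K"
  shows "finite (addable K)"
proof -
  obtain N where "\<And>i. N < i \<Longrightarrow> row_length K i = 0"
    using row_length_eventually_0[OF assms] by blast
  from addable_eq_image[OF assms this] show ?thesis by simp
qed

text \<open>Every addable cell outside the first row lies in the row below a removable cell, so the
  contributions cancel in pairs.\<close>

lemma sum_row_sign_addable_removable:
  assumes "young K"
  shows "sum row_sign (addable K) + sum row_sign (removable K) = 1"
proof -
  obtain N where N: "\<And>i. N < i \<Longrightarrow> row_length K i = 0"
    using row_length_eventually_0[OF assms] by blast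
  define s :: "nat \<Rightarrow> int" where "s i = (if even i then -1 else 1)" for i
  define A where "A i \<longleftrightarrow> i = 1 \<or> row_length K i < row_length K (i - 1)" for i
  define R where "R i \<longleftrightarrow> row_length K (Suc i) < row_length K i" for i
  have "addable K = (\<lambda>i. (i, Suc (row_length K i))) ` {i \<in> {1..Suc N}. A i}"
    unfolding A_def by (rule addable_eq_image[OF assms N])
  then have "sum row_sign (addable K) = (\<Sum>i \<in> {i \<in> {1..Suc N}. A i}. s i)"
    by (simp add: sum.reindex inj_on_def row_sign_def s_def)
  also have "\<dots> = (\<Sum>i=1..Suc N. if A i then s i else 0)"
    by (rule sum.inter_filter) simp
  also have "\<dots> = 1 + (\<Sum>i=Suc 1..Suc N. if A i then s i else 0)"
    by (subst sum.atLeast_Suc_atMost) (auto simp: A_def s_def)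
  also have "(\<Sum>i=Suc 1..Suc N. if A i then s i else 0) = (\<Sum>i=1..N. if A (Suc i) then s (Suc i) else 0)"
    by (rule sum.shift_bounds_cl_Suc_ivl)
  also have "\<dots> = - (\<Sum>i=1..N. if R i then s i else 0)"
    unfolding sum_negf[symmetric] by (rule sum.cong) (auto simp: A_def R_def s_def)
  finally have a: "sum row_sign (addable K) = 1 - (\<Sum>i=1..N. if R i then s i else 0)" by simp
  have "removable K = (\<lambda>i. (i, row_length K i)) ` {i \<in> {1..N}. R i}"
    unfolding R_def by (rule removable_eq_image[OF assms N])
  then have "sum row_sign (removable K) = (\<Sum>i \<in> {i \<in> {1..N}. R i}. s i)"
    by (simp add: sum.reindex inj_on_def row_sign_def s_def)
  also have "\<dots> = (\<Sum>i=1..N. if R i then s i else 0)"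
    by (rule sum.inter_filter) simp
  finally show ?thesis using a by simp
qed

section \<open>Partitions correspond to diagrams\<close>

lemma is_partition_nth_mono:
  assumes "is_partition p" "i \<le> j" "j < length p"
  shows "p ! j \<le> p ! i"
  using assms by (cases "i = j") (auto simp: is_partition_def sorted_wrt_iff_nth_less)

lemma young_cells:
  assumes "is_partition p"
  shows "young (cells p)"
proof -
  have "(i', j') \<in> cells p"
    if "(i, j) \<in> cells p" "1 \<le> i'" "i' \<le> i" "1 \<le> j'" "j' \<le> j" for i j i' j'
  proof -
    have "p ! (i - 1) \<le> p ! (i' - 1)"
      using that by (intro is_partition_nth_mono[OF assms]) (auto simp: cells_def)
    then show ?thesis using that by (auto simp: cells_def)
  qed
  moreover have "1 \<le> i \<and> 1 \<le> j" if "(i, j) \<in> cells p" for i j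
    using that by (simp add: cells_def)
  ultimately show ?thesis
    unfolding young_def using finite_cells by blast
qed

text \<open>Positive parts make every list position visible in the diagram: the cell in column 1
  detects the row, and the largest column present recovers the part.\<close>

lemma cells_eq_imp_eq:
  assumes "is_partition p" "is_partition q" "cells p = cells q"
  shows "p = q"
proof -
  have mem: "(Suc i, j) \<in> cells r \<longleftrightarrow> i < length r \<and> 1 \<le> j \<and> j \<le> r ! i" for i j r
    by (auto simp: cells_def)
  have pos: "1 \<le> r ! i" if "is_partition r" "i < length r" for r i
    using that by (metis One_nat_def Suc_leI gr0I is_partition_def nth_mem)
  have "i < length p \<longleftrightarrow> i < length q" for i
    using mem[of i 1 p] mem[of i 1 q] pos assms by auto
  then have len: "length p = length q" by (meson linorder_neqE_nat nat_neq_iff)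
  show ?thesis
  proof (rule nth_equalityI[OF len])
    fix i assume i: "i < length p"
    then have "j \<le> p ! i \<longleftrightarrow> j \<le> q ! i" if "1 \<le> j" for j
      using mem[of i j p] mem[of i j q] len that assms by auto
    then show "p ! i = q ! i"
      using pos[OF assms(1) i] pos[OF assms(2)] i len by (metis le_antisym order_refl)
  qed
qed

lemma young_imp_cells:
  assumes "young K"
  obtains p where "is_partition p" "cells p = K"
proof
  define I where "I = {i. 1 \<le> i \<and> row_length K i \<noteq> 0}"
  obtain N where N: "\<And>i. N < i \<Longrightarrow> row_length K i = 0"
    using row_length_eventually_0[OF assms] by blast
  define l where "l = card I"
  have finI: "finite I"
    by (rule finite_subset[of _ "{..N}"]) (use N in \<open>auto simp: I_def not_less[symmetric]\<close>)
  have downI: "i' \<in> I" if "i \<in> I" "1 \<le> i'" "i' \<le> i" for i i'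
    using that row_length_antimono[OF assms, of i' i] by (auto simp: I_def)
  \<comment> \<open>Row lengths decrease weakly, so the nonempty rows form an initial segment;
    listing their lengths in order leaves no zero part.\<close>
  have I: "I = {1..l}"
  proof -
    have sub: "I \<subseteq> {1..l}"
    proof
      fix i assume i: "i \<in> I"
      then have "{1..i} \<subseteq> I" using downI by auto
      then have "i \<le> l" using card_mono[OF finI, of "{1..i}"] by (simp add: l_def)
      then show "i \<in> {1..l}" using i by (auto simp: I_def)
    qed
    then show ?thesis by (intro card_subset_eq) (auto simp: l_def)
  qed
  define p where "p = map (row_length K) [1..<Suc l]"
  have nth: "p ! k = row_length K (Suc k)" if "k < l" for k
    using that by (simp add: p_def del: upt_Suc)
  have len: "length p = l" by (simp add: p_def)
  have "row_length K i \<noteq> 0" if "i \<in> {1..l}" for i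
    using that unfolding I[symmetric] by (simp add: I_def)
  then have "0 \<notin> set p" by (fastforce simp: p_def simp del: upt_Suc)
  moreover have "sorted_wrt (\<ge>) p"
    unfolding sorted_wrt_iff_nth_less using row_length_antimono[OF assms] by (auto simp: len nth)
  ultimately show "is_partition p" by (simp add: is_partition_def)
  have "(i, j) \<in> cells p \<longleftrightarrow> (i, j) \<in> K" for i j
  proof (cases "i \<in> I")
    case True
    then show ?thesis
      using I nth[of "i - 1"] mem_young_iff[OF assms] by (auto simp: cells_def len)
  next
    case False
    moreover have "(i, j) \<notin> cells p" using False I by (auto simp: cells_def len)
    ultimately show ?thesis using mem_young_iff[OF assms] by (auto simp: I_def)
  qed
  then show "cells p = K" by auto
qed

section \<open>Imbalance of a difference of diagrams\<close>

definition tableaux :: "cell set \<Rightarrow> (cell \<Rightarrow> nat) set" where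
  "tableaux S = {T \<in> extensional S. bij_betw T S {1..card S} \<and>
     (\<forall>i j i' j'. (i, j) \<in> S \<and> (i', j') \<in> S \<and> i \<le> i' \<and> j \<le> j' \<longrightarrow> T (i, j) \<le> T (i', j'))}"

definition inversions :: "cell set \<Rightarrow> (cell \<Rightarrow> nat) \<Rightarrow> (cell \<times> cell) set" where
  "inversions S T = {(a, b). a \<in> S \<and> b \<in> S \<and> a \<lhd>\<^sub>c b \<and> T a > T b}"

text \<open>The sign avoids a filling of \<open>M\<close>: the entries on \<open>M\<close> are
  smaller than all others, so a cell of \<open>K - M\<close> before a cell of \<open>M\<close>
  always gives an inversion, and the inversions inside \<open>M\<close> cancel against the sign of
  the filling.\<close>

definition diagram_imbalance :: "cell set \<Rightarrow> cell set \<Rightarrow> int" where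
  "diagram_imbalance K M = (\<Sum>T \<in> tableaux (K - M).
     (-1) ^ (card (inversions (K - M) T) + card {(a, b). a \<in> K - M \<and> b \<in> M \<and> a \<lhd>\<^sub>c b}))"

lemma imbalance_eq_diagram_imbalance:
  assumes "cells \<mu> \<subseteq> cells \<kappa>"
  shows "imbalance \<kappa> \<mu> = diagram_imbalance (cells \<kappa>) (cells \<mu>)"
proof -
  obtain T0 where T0: "T0 \<in> SYT \<mu> []" using SYT_straight_nonempty by blast
  have "SYT \<kappa> \<mu> = tableaux (cells \<kappa> - cells \<mu>)"
    by (simp add: SYT_def tableaux_def skew_def)
  then show ?thesis
    unfolding imbalance_def diagram_imbalance_def inversions_def
    by (intro sum.cong) (simp_all add: sign_skew_eq[OF assms _ T0] sign_straight_diamond[OF assms _ T0]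
        skew_def)
qed

lemma diagram_imbalance_refl: "diagram_imbalance K K = 1"
proof -
  have "tableaux {} = {\<lambda>_. undefined}" by (auto simp: tableaux_def bij_betw_def)
  then show ?thesis by (simp add: diagram_imbalance_def inversions_def)
qed

section \<open>Removing and inserting the largest entry\<close>

lemma tableaux_remove_max:
  assumes T: "T \<in> tableaux S" and c: "c \<in> S" "T c = card S" and fin: "finite S"
  shows "restrict T (S - {c}) \<in> tableaux (S - {c})"
proof -
  have bij: "bij_betw T S {1..card S}" using T by (simp add: tableaux_def)
  have "bij_betw T {c} {card S}" using c by (simp add: bij_betw_def)
  then have "bij_betw T (S - {c}) ({1..card S} - {card S})"
    using bij bij_betwE[OF bij] c by (intro bij_betw_DiffI) auto
  moreover have "{1..card S} - {card S} = {1..card (S - {c})}"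
    using c fin by (auto simp: card_Diff_singleton)
  ultimately have "bij_betw (restrict T (S - {c})) (S - {c}) {1..card (S - {c})}"
    by (metis (no_types, lifting) bij_betw_cong restrict_apply')
  then show ?thesis using T by (auto simp: tableaux_def)
qed

lemma tableaux_add_max:
  assumes T: "T \<in> tableaux (S - {c})" and c: "c \<in> S" and fin: "finite S"
    and max: "\<And>i j. (i, j) \<in> S \<Longrightarrow> fst c \<le> i \<Longrightarrow> snd c \<le> j \<Longrightarrow> (i, j) = c"
  shows "T(c := card S) \<in> tableaux S"
proof -
  have bij: "bij_betw T (S - {c}) {1..card (S - {c})}" using T by (simp add: tableaux_def)
  have card: "card S = Suc (card (S - {c}))" using c fin by (metis card_Suc_Diff1)
  have "bij_betw (T(c := card S)) (S - {c}) {1..card (S - {c})}"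
    using bij by (rule bij_betw_cong[THEN iffD1, rotated]) simp
  then have "bij_betw (T(c := card S)) (insert c (S - {c})) (insert (card S) {1..card (S - {c})})"
    using notIn_Un_bij_betw3[of c "S - {c}" "T(c := card S)" "{1..card (S - {c})}"] card by simp
  moreover have "insert c (S - {c}) = S" "insert (card S) {1..card (S - {c})} = {1..card S}"
    using c card by auto
  ultimately have bij': "bij_betw (T(c := card S)) S {1..card S}" by simp
  then have le: "(T(c := card S)) x \<le> card S" if "x \<in> S" for x
    using that bij_betwE by fastforce
  have "(T(c := card S)) (i, j) \<le> (T(c := card S)) (i', j')"
    if "(i, j) \<in> S" "(i', j') \<in> S" "i \<le> i'" "j \<le> j'" for i j i' j'
  proof (cases "(i', j') = c")
    case True
    then show ?thesis using le[OF that(1)] by simp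
  next
    case False
    then have "(i, j) \<noteq> c" using max[OF that(2)] that by auto
    then show ?thesis using False T that by (simp add: tableaux_def)
  qed
  moreover have "T(c := card S) \<in> extensional S"
    using T c by (auto simp: tableaux_def extensional_def)
  ultimately show ?thesis using bij' by (simp add: tableaux_def)
qed

text \<open>The entry at \<open>c\<close> exceeds all others, so a pair with \<open>c\<close> in
  first position is always an inversion and a pair with \<open>c\<close> in second position never
  is.\<close>

lemma card_inversions_add_max:
  assumes T: "T \<in> tableaux S" and c: "c \<in> S" "T c = card S" and fin: "finite S"
  shows "card (inversions S T) =
    card (inversions (S - {c}) (restrict T (S - {c}))) + card {b \<in> S. c \<lhd>\<^sub>c b}"
proof -
  have bij: "bij_betw T S {1..card S}" using T by (simp add: tableaux_def)
  have lt: "T b < T c" if "b \<in> S" "b \<noteq> c" for b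
  proof -
    have "T b \<noteq> T c" using that c bij by (auto simp: bij_betw_def inj_on_def)
    moreover have "T b \<le> card S" using that bij by (auto simp: bij_betw_def)
    ultimately show ?thesis using c by simp
  qed
  have irr: "\<not> c \<lhd>\<^sub>c c" by (simp add: cell_before_def)
  have eq: "inversions S T =
      inversions (S - {c}) (restrict T (S - {c})) \<union> Pair c ` {b \<in> S. c \<lhd>\<^sub>c b}"
    using lt c irr by (fastforce simp: inversions_def not_less_iff_gr_or_eq)
  have "finite (inversions S' T')" if "finite S'" for S' T'
    by (rule finite_subset[of _ "S' \<times> S'"]) (use that in \<open>auto simp: inversions_def\<close>)
  moreover have "inversions (S - {c}) (restrict T (S - {c})) \<inter> Pair c ` {b \<in> S. c \<lhd>\<^sub>c b} = {}"
    by (auto simp: inversions_def)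
  ultimately show ?thesis
    unfolding eq using fin by (simp add: card_Un_disjoint card_image inj_on_def)
qed

text \<open>Tableaux are sorted by the cell \<open>c\<close> of the largest entry, which exists
  because \<open>M \<noteq> K\<close>. Deleting it loses the inversions of \<open>c\<close> with
  later cells of \<open>K - M\<close> and the cross pairs of \<open>c\<close> with later cells of
  \<open>M\<close>: together one for each cell of \<open>K\<close> after \<open>c\<close>, hence the
  factor \<open>after_sign K c\<close>.\<close>

lemma diagram_imbalance_rec:
  assumes K: "young K" and M: "young M" and sub: "M \<subseteq> K" "M \<noteq> K"
  shows "diagram_imbalance K M =
    (\<Sum>c \<in> removable K - M. after_sign K c * diagram_imbalance (K - {c}) M)"
proof -
  define S where "S = K - M"
  have fin: "finite S" "finite M" "finite K" using K M by (auto simp: S_def young_finite)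
  have ne: "S \<noteq> {}" using sub by (auto simp: S_def)
  define X where "X L = {(a, b). a \<in> L \<and> b \<in> M \<and> a \<lhd>\<^sub>c b}" for L
  have SK: "K - {c} - M = S - {c}" for c by (auto simp: S_def)
  \<comment> \<open>Another cell weakly below and to the right of \<open>c\<close> would, in the
    diagram \<open>K - {c}\<close>, force \<open>c\<close> itself to be present.\<close>
  have max: "(i, j) = c" if c: "c \<in> removable K - M" and ij: "(i, j) \<in> S" "fst c \<le> i" "snd c \<le> j" for c i j
  proof (rule ccontr)
    assume "(i, j) \<noteq> c"
    then have "(i, j) \<in> K - {c}" using ij by (auto simp: S_def)
    moreover have "young (K - {c})" "c \<in> K" using c by (auto simp: removable_def)
    ultimately have "(fst c, snd c) \<in> K - {c}"
      using young_down[of "K - {c}" i j "fst c" "snd c"] ij young_pos[OF K, of "fst c" "snd c"] by auto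
    then show False by simp
  qed
  \<comment> \<open>A cell of \<open>K\<close> weakly below and to the right of the largest entry
    lies outside \<open>M\<close>, as \<open>M\<close> would otherwise contain \<open>c\<close>;
    monotonicity then makes it equal to \<open>c\<close>.\<close>
  have corner: "c \<in> removable K - M" if T: "T \<in> tableaux S" and c: "c \<in> S" "T c = card S" for T c
  proof -
    have max: "d = c" if "d \<in> S" "fst c \<le> fst d" "snd c \<le> snd d" for d
    proof -
      have "T (fst c, snd c) \<le> T (fst d, snd d)"
        using T that c unfolding tableaux_def by (metis (no_types, lifting) mem_Collect_eq prod.collapse)
      moreover have "T d \<le> card S" using T that by (auto simp: tableaux_def bij_betw_def)
      ultimately have "T d = T c" using c by simp
      then show ?thesis using T that c by (auto simp: tableaux_def bij_betw_def inj_on_def)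
    qed
    have cK: "c \<in> K" "c \<notin> M" using c by (auto simp: S_def)
    have "(i', j') \<noteq> c" if ij: "(i, j) \<in> K - {c}" "i' \<le> i" "j' \<le> j" for i j i' j'
    proof
      assume eq: "(i', j') = c"
      have "(i, j) \<notin> M"
        using young_down[OF M, of i j i' j'] young_pos[OF K, of i' j'] ij eq cK by auto
      then show False using max[of "(i, j)"] ij eq by (auto simp: S_def)
    qed
    then have "young (K - {c})"
      using K unfolding young_def by (metis DiffD1 DiffI finite_Diff singletonD)
    then show ?thesis using cK by (auto simp: removable_def)
  qed
  define top where "top T = inv_into S T (card S)" for T :: "cell \<Rightarrow> nat"
  have top: "top T \<in> S" "T (top T) = card S" if "T \<in> tableaux S" for T
  proof -
    have "card S \<in> T ` S"
      using that ne fin by (auto simp: tableaux_def bij_betw_def Suc_le_eq card_gt_0_iff)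
    then show "top T \<in> S" "T (top T) = card S"
      unfolding top_def by (simp_all add: inv_into_into f_inv_into_f)
  qed
  have top_upd: "top (T(c := card S)) = c" if "T(c := card S) \<in> tableaux S" "c \<in> S" for T c
    using top[OF that(1)] that unfolding tableaux_def bij_betw_def
    by (metis (no_types, lifting) fun_upd_same inj_onD mem_Collect_eq)
  have sgn: "(-1) ^ (card (inversions S T) + card (X S)) =
      after_sign K c * (-1) ^ (card (inversions (S - {c}) (restrict T (S - {c}))) + card (X (S - {c})))"
    if T: "T \<in> tableaux S" and c: "c \<in> S" "T c = card S" for T c
  proof -
    have X: "X S = X (S - {c}) \<union> Pair c ` {b \<in> M. c \<lhd>\<^sub>c b}"
      using c by (auto simp: X_def)
    have finX: "finite (X (S - {c}))"
      by (rule finite_subset[of _ "S \<times> M"]) (use fin in \<open>auto simp: X_def\<close>)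
    have "card (X S) = card (X (S - {c})) + card {b \<in> M. c \<lhd>\<^sub>c b}"
      unfolding X using fin finX by (subst card_Un_disjoint) (auto simp: X_def card_image inj_on_def)
    moreover have "card {b \<in> K. c \<lhd>\<^sub>c b} = card {b \<in> S. c \<lhd>\<^sub>c b} + card {b \<in> M. c \<lhd>\<^sub>c b}"
      using fin sub by (subst card_Un_disjoint[symmetric]) (auto simp: S_def intro!: arg_cong[of _ _ card])
    ultimately show ?thesis
      using card_inversions_add_max[OF T c fin(1)] by (simp add: after_sign_def power_add)
  qed
  have "diagram_imbalance K M = (\<Sum>T \<in> tableaux S. (-1) ^ (card (inversions S T) + card (X S)))"
    by (simp add: diagram_imbalance_def S_def X_def)
  \<comment> \<open>A tableau corresponds to the position of its largest entry together with its
    restriction to the other cells; \<open>top_upd\<close> recovers the position.\<close>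
  also have "\<dots> = (\<Sum>(c, T) \<in> Sigma (removable K - M) (\<lambda>c. tableaux (S - {c})).
      after_sign K c * (-1) ^ (card (inversions (S - {c}) T) + card (X (S - {c}))))"
  proof (rule sum.reindex_bij_witness[where i = "\<lambda>(c, T). T(c := card S)"
        and j = "\<lambda>T. (top T, restrict T (S - {top T}))"], goal_cases)
    case (1 T)
    show ?case using top[OF 1] 1
      by (auto simp: fun_eq_iff tableaux_def extensional_def)
  next
    case (2 T)
    show ?case using top[OF 2] corner[OF 2] tableaux_remove_max[OF 2 _ _ fin(1)] by auto
  next
    case (3 b)
    then obtain c T where b: "b = (c, T)" "c \<in> removable K - M" "T \<in> tableaux (S - {c})" by auto
    have cS: "c \<in> S" using b by (auto simp: S_def removable_def)
    have "T(c := card S) \<in> tableaux S"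
      using tableaux_add_max[OF b(3) cS fin(1)] max[OF b(2)] by blast
    then have "top (T(c := card S)) = c" using top_upd cS by blast
    then show ?case
      using b by (auto simp: fun_eq_iff tableaux_def extensional_def)
  next
    case (4 b)
    then obtain c T where b: "b = (c, T)" "c \<in> removable K - M" "T \<in> tableaux (S - {c})" by auto
    have cS: "c \<in> S" using b by (auto simp: S_def removable_def)
    show ?case
      using tableaux_add_max[OF b(3) cS fin(1)] max[OF b(2)] b by auto
  next
    case (5 T)
    show ?case using sgn[OF 5 top[OF 5]] by simp
  qed
  also have "\<dots> = (\<Sum>c \<in> removable K - M. \<Sum>T \<in> tableaux (S - {c}).
      after_sign K c * (-1) ^ (card (inversions (S - {c}) T) + card (X (S - {c}))))"
  proof (rule sum.Sigma[symmetric])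
    show "finite (removable K - M)" using finite_removable[OF K] by simp
    have "finite (tableaux L)" if "finite L" for L
    proof (rule finite_subset)
      show "tableaux L \<subseteq> L \<rightarrow>\<^sub>E {1..card L}"
        by (auto simp: tableaux_def PiE_def bij_betw_def)
    qed (simp add: finite_PiE that)
    then show "\<forall>c \<in> removable K - M. finite (tableaux (S - {c}))" using fin by simp
  qed
  also have "\<dots> = (\<Sum>c \<in> removable K - M. after_sign K c * diagram_imbalance (K - {c}) M)"
    by (simp add: diagram_imbalance_def SK X_def sum_distrib_left)
  finally show ?thesis .
qed

section \<open>The up and down operators\<close>

text \<open>A function is read as a vector of coefficients, so the coefficient of
  \<open>up f\<close> at \<open>K\<close> collects those of the smaller diagrams
  \<open>K - {c}\<close>. The value \<open>0\<close> off diagrams lets operator identities be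
  equalities of functions.\<close>

definition up :: "(cell set \<Rightarrow> int) \<Rightarrow> cell set \<Rightarrow> int" where
  "up f K = (if young K then \<Sum>c \<in> removable K. after_sign K c * f (K - {c}) else 0)"

text \<open>The factor \<open>row_sign c\<close> is the ratio of the values of \<open>(-1)^v\<close>
  at \<open>insert c K\<close> and at \<open>K\<close>, which is the conjugation applied to the
  transpose of \<open>up\<close>.\<close>

definition down :: "(cell set \<Rightarrow> int) \<Rightarrow> cell set \<Rightarrow> int" where
  "down f K =
    (if young K then \<Sum>c \<in> addable K. row_sign c * after_sign K c * f (insert c K) else 0)"

section \<open>Signs when a cell is added or removed\<close>

lemma after_sign_insert:
  assumes "finite K" "d \<notin> K"
  shows "after_sign (insert d K) c = (if c \<lhd>\<^sub>c d then - after_sign K c else after_sign K c)"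
proof (cases "c \<lhd>\<^sub>c d")
  case True
  then have "{b \<in> insert d K. c \<lhd>\<^sub>c b} = insert d {b \<in> K. c \<lhd>\<^sub>c b}" by auto
  then show ?thesis using assms True by (simp add: after_sign_def)
next
  case False
  then have "{b \<in> insert d K. c \<lhd>\<^sub>c b} = {b \<in> K. c \<lhd>\<^sub>c b}" by auto
  then show ?thesis using False by (simp add: after_sign_def)
qed

lemma after_sign_remove_self: "after_sign (K - {c}) c = after_sign K c"
  unfolding after_sign_def
  by (rule arg_cong[where f = "\<lambda>S. (-1) ^ card S"]) (auto simp: cell_before_def)

lemma after_sign_insert_self: "after_sign (insert c K) c = after_sign K c"
  unfolding after_sign_def
  by (rule arg_cong[where f = "\<lambda>S. (-1) ^ card S"]) (auto simp: cell_before_def)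

lemma after_sign_square: "after_sign K c * after_sign K c = 1"
  by (simp add: after_sign_def flip: power_mult_distrib)

text \<open>Compare with the diagram \<open>K - {d}\<close>, which has neither cell. The left side
  changes sign once if \<open>d\<close> is after \<open>c\<close> and once if \<open>c\<close> is
  after \<open>d\<close>; for distinct cells exactly one of these happens. The right side does not
  change.\<close>

lemma after_sign_swap:
  assumes K: "finite K" and "d \<in> K" "c \<notin> K"
  shows "after_sign K c * after_sign (insert c K) d =
    - (after_sign K d * after_sign (K - {d}) c)"
proof -
  define L where "L = K - {d}"
  have L: "finite L" "d \<notin> L" "c \<notin> L" "K = insert d L" "c \<noteq> d"
    using assms by (auto simp: L_def)
  have "c \<lhd>\<^sub>c d \<longleftrightarrow> \<not> d \<lhd>\<^sub>c c"
    using L(5) by (cases c; cases d) (auto simp: cell_before_def)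
  moreover have "after_sign (insert c K) d = (if d \<lhd>\<^sub>c c then - after_sign L d else after_sign L d)"
    using after_sign_insert[OF K assms(3), of d] by (simp add: L after_sign_insert_self)
  ultimately show ?thesis
    using L by (simp add: after_sign_insert after_sign_insert_self)
qed

text \<open>Terms that add and remove the same cell return to \<open>K\<close> with sign
  \<open>row_sign c\<close>, and by \<open>sum_row_sign_addable_removable\<close> they total
  \<open>f K\<close>. The other terms of the two products match under swapping the two moves and
  cancel by \<open>after_sign_swap\<close>.\<close>

lemma down_up_plus_up_down:
  assumes K: "young K"
  shows "down (up f) K + up (down f) K = f K"
proof -
  let ?A = "\<lambda>c d. row_sign c * after_sign K c * (after_sign (insert c K) d * f (insert c K - {d}))"
  let ?B = "\<lambda>d c. after_sign K d * (row_sign c * after_sign (K - {d}) c * f (insert c (K - {d})))"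
  let ?SA = "Sigma (addable K) (\<lambda>c. removable (insert c K) - {c})"
  let ?SB = "Sigma (removable K) (\<lambda>d. addable (K - {d}) - {d})"
  have A: "(\<Sum>d \<in> removable (insert c K). ?A c d) =
      row_sign c * f K + (\<Sum>d \<in> removable (insert c K) - {c}. ?A c d)"
    if c: "c \<in> addable K" for c
  proof -
    have "insert c K - {c} = K" "young (insert c K)" using c by (auto simp: addable_def)
    then have "c \<in> removable (insert c K)" "finite (removable (insert c K))"
      using K by (simp_all add: finite_removable, simp add: removable_def)
    then show ?thesis
      using \<open>insert c K - {c} = K\<close> after_sign_square[of K c]
      by (simp add: sum.remove[of _ c] after_sign_insert_self algebra_simps)
  qed
  have B: "(\<Sum>c \<in> addable (K - {d}). ?B d c) =
      row_sign d * f K + (\<Sum>c \<in> addable (K - {d}) - {d}. ?B d c)"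
    if d: "d \<in> removable K" for d
  proof -
    have "insert d (K - {d}) = K" "young (K - {d})" using d by (auto simp: removable_def)
    then have "d \<in> addable (K - {d})" "finite (addable (K - {d}))"
      using K by (simp_all add: finite_addable, simp add: addable_def)
    then show ?thesis
      using \<open>insert d (K - {d}) = K\<close> after_sign_square[of K d]
      by (simp add: sum.remove[of _ d] after_sign_remove_self algebra_simps)
  qed
  have "down (up f) K = (\<Sum>c \<in> addable K. \<Sum>d \<in> removable (insert c K). ?A c d)"
    using K by (auto simp: down_def up_def addable_def sum_distrib_left intro!: sum.cong)
  also have "\<dots> = (\<Sum>c \<in> addable K. row_sign c * f K + (\<Sum>d \<in> removable (insert c K) - {c}. ?A c d))"
    by (rule sum.cong[OF refl A])
  also have "\<dots> = sum row_sign (addable K) * f K + (\<Sum>(c, d) \<in> ?SA. ?A c d)"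
    using finite_addable[OF K] finite_removable
    by (subst sum.Sigma[symmetric]) (auto simp: sum.distrib sum_distrib_right addable_def)
  finally have du: "down (up f) K = sum row_sign (addable K) * f K + (\<Sum>(c, d) \<in> ?SA. ?A c d)" .
  have "up (down f) K = (\<Sum>d \<in> removable K. \<Sum>c \<in> addable (K - {d}). ?B d c)"
    using K by (auto simp: down_def up_def removable_def sum_distrib_left intro!: sum.cong)
  also have "\<dots> = (\<Sum>d \<in> removable K. row_sign d * f K + (\<Sum>c \<in> addable (K - {d}) - {d}. ?B d c))"
    by (rule sum.cong[OF refl B])
  also have "\<dots> = sum row_sign (removable K) * f K + (\<Sum>(d, c) \<in> ?SB. ?B d c)"
    using finite_removable[OF K] finite_addable
    by (subst sum.Sigma[symmetric]) (auto simp: sum.distrib sum_distrib_right removable_def)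
  finally have ud: "up (down f) K = sum row_sign (removable K) * f K + (\<Sum>(d, c) \<in> ?SB. ?B d c)" .
  \<comment> \<open>The diagram needed for removing first, \<open>K - {d}\<close>, is the
    intersection of the diagrams \<open>K\<close> and \<open>insert c K - {d}\<close>.\<close>
  have AB: "(d, c) \<in> ?SB" if "(c, d) \<in> ?SA" for c d
  proof -
    have y: "young (insert c K)" "young (insert c K - {d})" "c \<notin> K" "d \<in> K" "d \<noteq> c"
      using that by (auto simp: addable_def removable_def)
    have "K - {d} = K \<inter> (insert c K - {d})" "insert c (K - {d}) = insert c K - {d}"
      using y by auto
    then have "young (K - {d})" "young (insert c (K - {d}))"
      using y young_Int[OF K] by metis+
    then show ?thesis using y by (auto simp: addable_def removable_def)
  qed
  \<comment> \<open>Dually, \<open>insert c K\<close> is a union of two diagrams.\<close>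
  have BA: "(c, d) \<in> ?SA" if "(d, c) \<in> ?SB" for c d
  proof -
    have y: "young (K - {d})" "young (insert c (K - {d}))" "c \<notin> K" "d \<in> K" "d \<noteq> c"
      using that by (auto simp: addable_def removable_def)
    have "insert c K = K \<union> insert c (K - {d})" "insert c (K - {d}) = insert c K - {d}"
      using y by auto
    then have "young (insert c K)" "young (insert c K - {d})"
      using y young_Un[OF K] by metis+
    then show ?thesis using y by (auto simp: addable_def removable_def)
  qed
  have sgn: "?A c d = - ?B d c" if "(c, d) \<in> ?SA" for c d
  proof -
    have y: "c \<notin> K" "d \<in> K" "d \<noteq> c"
      using that by (auto simp: addable_def removable_def)
    have "insert c (K - {d}) = insert c K - {d}" using y by auto
    then have "?A c d = row_sign c * (after_sign K c * after_sign (insert c K) d) * f (insert c (K - {d}))"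
      by simp
    also have "\<dots> = - ?B d c"
      unfolding after_sign_swap[OF young_finite[OF K] y(2,1)] by simp
    finally show ?thesis .
  qed
  have "(\<Sum>(c, d) \<in> ?SA. ?A c d) = (\<Sum>(d, c) \<in> ?SB. - ?B d c)"
  proof (rule sum.reindex_bij_witness[where i = prod.swap and j = prod.swap])
    fix a assume a: "a \<in> ?SA"
    obtain c d where cd: "a = (c, d)" by (cases a)
    show "prod.swap a \<in> ?SB" using AB a unfolding cd prod.swap_def fst_conv snd_conv .
    show "(case prod.swap a of (d, c) \<Rightarrow> - ?B d c) = (case a of (c, d) \<Rightarrow> ?A c d)"
      using sgn[OF a[unfolded cd]] unfolding cd prod.swap_def fst_conv snd_conv prod.case by (rule sym)
  next
    fix b assume b: "b \<in> ?SB"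
    obtain d c where dc: "b = (d, c)" by (cases b)
    show "prod.swap b \<in> ?SA" using BA b unfolding dc prod.swap_def fst_conv snd_conv .
  qed simp_all
  also have "\<dots> = - (\<Sum>(d, c) \<in> ?SB. ?B d c)"
    by (simp add: sum_negf split_def)
  finally have "down (up f) K + up (down f) K =
      (sum row_sign (addable K) + sum row_sign (removable K)) * f K"
    using du ud by (simp add: algebra_simps)
  then show ?thesis by (simp add: sum_row_sign_addable_removable[OF K])
qed

section \<open>Commutation of powers of the operators\<close>

definition on_diagrams :: "(cell set \<Rightarrow> int) \<Rightarrow> bool" where
  "on_diagrams f \<longleftrightarrow> (\<forall>K. \<not> young K \<longrightarrow> f K = 0)"

lemma on_diagrams_up: "on_diagrams (up f)"
  by (simp add: on_diagrams_def up_def)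

lemma on_diagrams_down: "on_diagrams (down f)"
  by (simp add: on_diagrams_def down_def)

lemma on_diagrams_up_pow: "on_diagrams f \<Longrightarrow> on_diagrams ((up ^^ n) f)"
  by (cases n) (auto simp: on_diagrams_up)

lemma on_diagrams_down_pow: "on_diagrams f \<Longrightarrow> on_diagrams ((down ^^ n) f)"
  by (cases n) (auto simp: on_diagrams_down)

lemma up_diff: "up (\<lambda>K. f K - g K) = (\<lambda>K. up f K - up g K)"
  by (auto simp: up_def fun_eq_iff algebra_simps sum_subtractf)

lemma down_diff: "down (\<lambda>K. f K - g K) = (\<lambda>K. down f K - down g K)"
  by (auto simp: down_def fun_eq_iff algebra_simps sum_subtractf)

lemma down_pow_diff: "(down ^^ m) (\<lambda>K. f K - g K) = (\<lambda>K. (down ^^ m) f K - (down ^^ m) g K)"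
  by (induction m) (auto simp: down_diff)

text \<open>The relation \<open>down_up_plus_up_down\<close> speaks only of diagrams. Since
  \<open>f\<close> vanishes elsewhere, it becomes an equality of functions, usable under further
  operators.\<close>

lemma down_up:
  assumes "on_diagrams f"
  shows "down (up f) = (\<lambda>K. f K - up (down f) K)"
proof
  fix K
  show "down (up f) K = f K - up (down f) K"
  proof (cases "young K")
    case True
    then show ?thesis using down_up_plus_up_down[of K f] by simp
  next
    case False
    then show ?thesis using assms by (simp add: on_diagrams_def down_def up_def)
  qed
qed

text \<open>Two uses of \<open>D U = 1 - U D\<close> give
  \<open>D U U = U - U D U = U - U (1 - U D) = U U D\<close>.\<close>

lemma down_up_up: "on_diagrams f \<Longrightarrow> down (up (up f)) = up (up (down f))"
  by (simp add: down_up[OF on_diagrams_up] down_up up_diff)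

lemma down_down_up: "on_diagrams f \<Longrightarrow> down (down (up f)) = up (down (down f))"
  by (simp add: down_up down_diff down_up[OF on_diagrams_down])

lemma down_up_pow_even:
  assumes "even n" "on_diagrams f"
  shows "down ((up ^^ n) f) = (up ^^ n) (down f)"
proof -
  have "down ((up ^^ (2 * k)) f) = (up ^^ (2 * k)) (down f)" for k
    by (induction k) (simp_all add: down_up_up on_diagrams_up_pow assms(2))
  then show ?thesis using assms(1) by (auto elim: evenE)
qed

lemma down_pow_even_up:
  assumes "even m" "on_diagrams f"
  shows "(down ^^ m) (up f) = up ((down ^^ m) f)"
proof -
  have "(down ^^ (2 * k)) (up f) = up ((down ^^ (2 * k)) f)" for k
    by (induction k) (simp_all add: down_down_up on_diagrams_down_pow assms(2))
  then show ?thesis using assms(1) by (auto elim: evenE)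
qed

text \<open>An even power commutes with a single opposite operator, so induction on the other
  exponent suffices.\<close>

lemma down_pow_up_pow_commute:
  assumes "even m \<or> even n" "on_diagrams f"
  shows "(down ^^ m) ((up ^^ n) f) = (up ^^ n) ((down ^^ m) f)"
proof (cases "even n")
  case True
  then show ?thesis
    by (induction m) (simp_all add: down_up_pow_even on_diagrams_down_pow assms(2))
next
  case False
  then have "even m" using assms(1) by blast
  then show ?thesis
    by (induction n) (simp_all add: down_pow_even_up on_diagrams_up_pow assms(2))
qed

text \<open>The factor \<open>D U\<close> in the middle is replaced by \<open>1 - U D\<close>;
  around it stand the even powers with exponents \<open>m - 1\<close> and \<open>n - 1\<close>,
  which move past the opposite operator without a sign.\<close>

lemma down_pow_up_pow_odd:
  assumes "odd m" "odd n" "on_diagrams f"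
  shows "(down ^^ m) ((up ^^ n) f) =
    (\<lambda>K. (up ^^ (n - 1)) ((down ^^ (m - 1)) f) K - (up ^^ n) ((down ^^ m) f) K)"
proof -
  obtain m' n' where mn: "m = Suc m'" "n = Suc n'" "even m'" "even n'"
    using assms by (metis Suc_pred even_Suc odd_pos)
  define g where "g = (up ^^ n') f"
  have g: "on_diagrams g" by (simp add: g_def on_diagrams_up_pow assms(3))
  have "(down ^^ m) ((up ^^ n) f) = (down ^^ m') (down (up g))"
    by (simp add: mn g_def flip: funpow_swap1)
  also have "\<dots> = (\<lambda>K. (down ^^ m') g K - (down ^^ m') (up (down g)) K)"
    by (simp add: down_up g down_pow_diff)
  also have "(down ^^ m') (up (down g)) = up ((down ^^ m') (down g))"
    by (rule down_pow_even_up[OF mn(3) on_diagrams_down])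
  also have "down g = (up ^^ n') (down f)"
    unfolding g_def by (rule down_up_pow_even[OF mn(4) assms(3)])
  also have "(down ^^ m') ((up ^^ n') (down f)) = (up ^^ n') ((down ^^ m') (down f))"
    using mn by (intro down_pow_up_pow_commute on_diagrams_down) auto
  also have "(down ^^ m') (down f) = (down ^^ m) f" by (simp add: mn funpow_swap1)
  also have "(down ^^ m') g = (up ^^ n') ((down ^^ m') f)"
    unfolding g_def using mn assms(3) by (intro down_pow_up_pow_commute) auto
  finally show ?thesis by (simp add: mn)
qed

section \<open>Powers of the operators in terms of imbalances\<close>

definition diagrams_below :: "cell set \<Rightarrow> nat \<Rightarrow> cell set set" where
  "diagrams_below K n = {M. young M \<and> M \<subseteq> K \<and> card (K - M) = n}"

definition diagrams_above :: "cell set \<Rightarrow> nat \<Rightarrow> cell set set" where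
  "diagrams_above M n = {K. young K \<and> M \<subseteq> K \<and> card (K - M) = n}"

lemma finite_diagrams_below: "young K \<Longrightarrow> finite (diagrams_below K n)"
  by (rule finite_subset[of _ "Pow K"]) (auto simp: diagrams_below_def young_finite)

lemma skew_of_size_int:
  "skew_of_size \<kappa> \<mu> (int n) \<longleftrightarrow> cells \<mu> \<subseteq> cells \<kappa> \<and> card (cells \<kappa> - cells \<mu>) = n"
  by (simp add: skew_of_size_def skew_def)

lemma finite_diagrams_above:
  assumes "young M"
  shows "finite (diagrams_above M n)"
proof -
  obtain \<mu> where "cells \<mu> = M" using young_imp_cells[OF assms] by blast
  then have "diagrams_above M n \<subseteq> cells ` {\<kappa>. is_partition \<kappa> \<and> skew_of_size \<kappa> \<mu> (int n)}"
    by (auto simp: diagrams_above_def skew_of_size_int elim!: young_imp_cells)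
  then show ?thesis
    by (rule finite_subset) (intro finite_imageI finite_partitions_skew_of_size)
qed

text \<open>The outermost \<open>up\<close> strips a cell from \<open>K\<close>, just as
  \<open>diagram_imbalance_rec\<close> does, so the induction varies \<open>K\<close>. Exchanging
  the sums over the stripped cell and over \<open>M\<close> turns one into the other.\<close>

lemma up_pow_eq:
  assumes "young K"
  shows "(up ^^ n) f K = (\<Sum>M \<in> diagrams_below K n. diagram_imbalance K M * f M)"
  using assms
proof (induction n arbitrary: K)
  case 0
  have "diagrams_below K 0 = {K}"
    using 0 by (auto simp: diagrams_below_def young_finite)
  then show ?case by (simp add: diagram_imbalance_refl)
next
  case (Suc n)
  note K = Suc.prems
  let ?B = "diagrams_below K (Suc n)"
  have below: "diagrams_below (K - {c}) n = {M \<in> ?B. c \<notin> M}" if c: "c \<in> removable K" for c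
  proof -
    have "card (K - M) = Suc (card (K - {c} - M))" if "c \<notin> M" for M
    proof -
      have "K - M = insert c (K - {c} - M)" using c that by (auto simp: removable_def)
      then show ?thesis using young_finite[OF K] by (metis DiffD1 DiffD2 card_insert_disjoint finite_Diff singletonI)
    qed
    then show ?thesis by (auto simp: diagrams_below_def)
  qed
  have "(up ^^ Suc n) f K =
      (\<Sum>c \<in> removable K. \<Sum>M \<in> {M \<in> ?B. c \<notin> M}. after_sign K c * (diagram_imbalance (K - {c}) M * f M))"
  proof -
    have "(up ^^ n) f (K - {c}) = (\<Sum>M \<in> {M \<in> ?B. c \<notin> M}. diagram_imbalance (K - {c}) M * f M)"
      if c: "c \<in> removable K" for c
      using Suc.IH[of "K - {c}"] c below[OF c] by (simp add: removable_def)
    then show ?thesis using K by (simp add: up_def sum_distrib_left)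
  qed
  also have "\<dots> = (\<Sum>M \<in> ?B. \<Sum>c \<in> {c \<in> removable K. c \<notin> M}.
      after_sign K c * (diagram_imbalance (K - {c}) M * f M))"
    by (rule sum.swap_restrict) (simp_all add: K finite_removable finite_diagrams_below)
  also have "\<dots> = (\<Sum>M \<in> ?B. diagram_imbalance K M * f M)"
  proof (rule sum.cong[OF refl])
    fix M assume "M \<in> ?B"
    then have M: "young M" "M \<subseteq> K" "M \<noteq> K" by (auto simp: diagrams_below_def)
    have "{c \<in> removable K. c \<notin> M} = removable K - M" by auto
    then show "(\<Sum>c \<in> {c \<in> removable K. c \<notin> M}. after_sign K c * (diagram_imbalance (K - {c}) M * f M)) =
        diagram_imbalance K M * f M"
      unfolding diagram_imbalance_rec[OF K M] by (simp add: sum_distrib_right mult.assoc)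
  qed
  finally show ?case .
qed

lemma even_rows_sign_insert:
  assumes "finite K" "c \<notin> K"
  shows "(-1) ^ even_rows (insert c K) = row_sign c * (-1) ^ even_rows K"
proof -
  have fin: "finite {(i, j) \<in> K. even i}"
    by (rule finite_subset[OF _ assms(1)]) auto
  have "{(i, j) \<in> insert c K. even i} = (if even (fst c) then insert c {(i, j) \<in> K. even i} else {(i, j) \<in> K. even i})"
    by (cases c) auto
  moreover have "c \<notin> {(i, j) \<in> K. even i}" using assms(2) by auto
  ultimately show ?thesis
    unfolding even_rows_def row_sign_def using fin by simp
qed

text \<open>Here the cell added last belongs to the innermost \<open>down\<close>, next to
  \<open>f\<close>. As \<open>diagram_imbalance_rec\<close> strips that cell, the induction varies
  \<open>f\<close> and keeps \<open>M\<close> fixed.\<close>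

lemma down_pow_eq:
  assumes M: "young M"
  shows "(down ^^ m) f M =
    (\<Sum>K \<in> diagrams_above M m. (-1) ^ (even_rows K + even_rows M) * diagram_imbalance K M * f K)"
proof (induction m arbitrary: f)
  case 0
  have "diagrams_above M 0 = {M}"
    using M by (auto simp: diagrams_above_def young_finite)
  then show ?case by (simp add: diagram_imbalance_refl flip: power_mult_distrib mult_2)
next
  case (Suc m)
  let ?s = "\<lambda>K. (-1) ^ (even_rows K + even_rows M) :: int"
  let ?S = "Sigma (diagrams_above M m) addable"
  let ?S' = "Sigma (diagrams_above M (Suc m)) (\<lambda>K. removable K - M)"
  have "(down ^^ Suc m) f M = (down ^^ m) (down f) M" by (simp add: funpow_swap1)
  also have "\<dots> = (\<Sum>K \<in> diagrams_above M m. \<Sum>c \<in> addable K.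
      ?s K * diagram_imbalance K M * (row_sign c * after_sign K c * f (insert c K)))"
    unfolding Suc.IH by (rule sum.cong) (auto simp: diagrams_above_def down_def sum_distrib_left)
  also have "\<dots> = (\<Sum>(K, c) \<in> ?S.
      ?s K * diagram_imbalance K M * (row_sign c * after_sign K c * f (insert c K)))"
    by (rule sum.Sigma) (use finite_diagrams_above[OF M] finite_addable in \<open>auto simp: diagrams_above_def\<close>)
  \<comment> \<open>A diagram with an addable cell is renamed as the larger diagram with a removable
    cell outside \<open>M\<close>; \<open>row_sign c\<close> carries the parity of
    \<open>even_rows\<close> over to the larger diagram.\<close>
  also have "\<dots> = (\<Sum>(K, c) \<in> ?S'. ?s K * (after_sign K c * diagram_imbalance (K - {c}) M) * f K)"
  proof (rule sum.reindex_bij_witness[where i = "\<lambda>(K, c). (K - {c}, c)" and j = "\<lambda>(K, c). (insert c K, c)"],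
      goal_cases)
    case (1 a)
    then show ?case by (auto simp: addable_def)
  next
    case (2 a)
    then obtain K c where a: "a = (K, c)" "young K" "M \<subseteq> K" "card (K - M) = m" "c \<notin> K" "young (insert c K)"
      by (auto simp: diagrams_above_def addable_def)
    then have "insert c K - M = insert c (K - M)" "insert c K - {c} = K" by auto
    then show ?case using a young_finite[OF a(2)]
      by (auto simp: diagrams_above_def removable_def)
  next
    case (3 a)
    then show ?case by (auto simp: removable_def)
  next
    case (4 a)
    then obtain K c where a: "a = (K, c)" "young K" "M \<subseteq> K" "card (K - M) = Suc m" "c \<in> K" "c \<notin> M"
      "young (K - {c})"
      by (auto simp: diagrams_above_def removable_def)
    then have "K - {c} - M = (K - M) - {c}" "insert c (K - {c}) = K" "c \<in> K - M" by auto
    then show ?case using a young_finite[OF a(2)]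
      by (auto simp: diagrams_above_def addable_def)
  next
    case (5 a)
    then obtain K c where a: "a = (K, c)" "young K" "c \<notin> K"
      by (auto simp: diagrams_above_def addable_def)
    then have "insert c K - {c} = K" by auto
    then show ?case
      using a young_finite[OF a(2)]
      by (simp add: after_sign_insert_self power_add even_rows_sign_insert algebra_simps)
  qed
  also have "\<dots> = (\<Sum>K \<in> diagrams_above M (Suc m). \<Sum>c \<in> removable K - M.
      ?s K * (after_sign K c * diagram_imbalance (K - {c}) M) * f K)"
    by (rule sum.Sigma[symmetric])
      (use finite_diagrams_above[OF M] finite_removable in \<open>auto simp: diagrams_above_def\<close>)
  also have "\<dots> = (\<Sum>K \<in> diagrams_above M (Suc m). ?s K * diagram_imbalance K M * f K)"
  proof (rule sum.cong[OF refl])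
    fix K assume "K \<in> diagrams_above M (Suc m)"
    then have K: "young K" "M \<subseteq> K" "M \<noteq> K" by (auto simp: diagrams_above_def)
    show "(\<Sum>c \<in> removable K - M. ?s K * (after_sign K c * diagram_imbalance (K - {c}) M) * f K) =
        ?s K * diagram_imbalance K M * f K"
      unfolding diagram_imbalance_rec[OF K(1) M K(2,3)] by (simp add: sum_distrib_left sum_distrib_right)
  qed
  finally show ?case .
qed

section \<open>The sums of the theorem as matrix entries\<close>

lemma v_eq_even_rows: "v \<kappa> = even_rows (cells \<kappa>)"
  by (simp add: v_def even_rows_def)

definition upper_sum :: "nat list \<Rightarrow> nat list \<Rightarrow> nat \<Rightarrow> nat \<Rightarrow> int" where
  "upper_sum \<alpha> \<beta> m n =
    (\<Sum>\<kappa> \<in> {\<kappa>. is_partition \<kappa> \<and> skew_of_size \<kappa> \<alpha> (int m) \<and> skew_of_size \<kappa> \<beta> (int n)}.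
       (-1) ^ v \<kappa> * imbalance \<kappa> \<alpha> * imbalance \<kappa> \<beta>)"

definition lower_sum :: "nat list \<Rightarrow> nat list \<Rightarrow> nat \<Rightarrow> nat \<Rightarrow> int" where
  "lower_sum \<alpha> \<beta> m n =
    (\<Sum>\<mu> \<in> {\<mu>. is_partition \<mu> \<and> skew_of_size \<beta> \<mu> (int m) \<and> skew_of_size \<alpha> \<mu> (int n)}.
       (-1) ^ v \<mu> * imbalance \<beta> \<mu> * imbalance \<alpha> \<mu>)"

text \<open>Applying an operator to this unit vector and evaluating at \<open>cells \<alpha>\<close>
  reads off one matrix entry.\<close>

abbreviation delta :: "nat list \<Rightarrow> cell set \<Rightarrow> int" where
  "delta \<beta> K \<equiv> if K = cells \<beta> then 1 else 0"

text \<open>Together with \<open>inj_on_cells\<close> this turns sums over diagrams into sums over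
  partitions.\<close>

lemma cells_image_Collect:
  "cells ` {\<kappa>. is_partition \<kappa> \<and> P (cells \<kappa>)} = {K. young K \<and> P K}"
  by (auto simp: young_cells elim!: young_imp_cells)

lemma inj_on_cells: "inj_on cells {\<kappa>. is_partition \<kappa> \<and> P \<kappa>}"
  by (auto simp: inj_on_def intro: cells_eq_imp_eq)

text \<open>From \<beta> the operators climb \<open>n\<close> cells to a diagram \<open>K\<close>
  and then descend \<open>m\<close> cells to \<alpha>, so \<open>K\<close> contains both. Of the
  sign in \<open>down_pow_eq\<close>, the part at \<open>K\<close> stays in the sum and the part at
  \<alpha> is taken out.\<close>

lemma down_pow_up_pow_delta:
  assumes "is_partition \<alpha>" "is_partition \<beta>"
  shows "(down ^^ m) ((up ^^ n) (delta \<beta>)) (cells \<alpha>) = (-1) ^ v \<alpha> * upper_sum \<alpha> \<beta> m n"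
proof -
  let ?P = "\<lambda>K. cells \<alpha> \<subseteq> K \<and> card (K - cells \<alpha>) = m \<and> cells \<beta> \<subseteq> K \<and> card (K - cells \<beta>) = n"
  let ?I = diagram_imbalance
  have up: "(up ^^ n) (delta \<beta>) K =
      (if cells \<beta> \<subseteq> K \<and> card (K - cells \<beta>) = n then ?I K (cells \<beta>) else 0)" if "young K" for K
    using young_cells[OF assms(2)]
    by (simp add: up_pow_eq[OF that] if_distrib[of "\<lambda>x. _ * x"] finite_diagrams_below[OF that]
        cong: if_cong) (auto simp: diagrams_below_def)
  have "(down ^^ m) ((up ^^ n) (delta \<beta>)) (cells \<alpha>) =
      (\<Sum>K \<in> diagrams_above (cells \<alpha>) m. if cells \<beta> \<subseteq> K \<and> card (K - cells \<beta>) = n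
         then (-1) ^ (even_rows K + v \<alpha>) * ?I K (cells \<alpha>) * ?I K (cells \<beta>) else 0)"
    unfolding down_pow_eq[OF young_cells[OF assms(1)]] v_eq_even_rows
    by (rule sum.cong) (auto simp: up diagrams_above_def)
  also have "\<dots> = (\<Sum>K \<in> {K \<in> diagrams_above (cells \<alpha>) m. cells \<beta> \<subseteq> K \<and> card (K - cells \<beta>) = n}.
      (-1) ^ (even_rows K + v \<alpha>) * ?I K (cells \<alpha>) * ?I K (cells \<beta>))"
    by (rule sum.inter_filter[symmetric]) (rule finite_diagrams_above[OF young_cells[OF assms(1)]])
  also have "{K \<in> diagrams_above (cells \<alpha>) m. cells \<beta> \<subseteq> K \<and> card (K - cells \<beta>) = n} =
      cells ` {\<kappa>. is_partition \<kappa> \<and> ?P (cells \<kappa>)}"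
    unfolding cells_image_Collect[of ?P] by (auto simp: diagrams_above_def)
  also have "(\<Sum>K \<in> \<dots>. (-1) ^ (even_rows K + v \<alpha>) * ?I K (cells \<alpha>) * ?I K (cells \<beta>)) =
      (\<Sum>\<kappa> \<in> {\<kappa>. is_partition \<kappa> \<and> ?P (cells \<kappa>)}.
        (-1) ^ (v \<kappa> + v \<alpha>) * ?I (cells \<kappa>) (cells \<alpha>) * ?I (cells \<kappa>) (cells \<beta>))"
    by (simp add: sum.reindex[OF inj_on_cells] v_eq_even_rows)
  also have "\<dots> = (-1) ^ v \<alpha> * upper_sum \<alpha> \<beta> m n"
    unfolding upper_sum_def sum_distrib_left
    by (rule sum.cong) (auto simp: skew_of_size_int imbalance_eq_diagram_imbalance power_add)
  finally show ?thesis .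
qed

text \<open>Now the descent from \<beta> comes first and ends at \<mu>, so the constant part of the
  sign belongs to \<beta>; the climb to \<alpha> adds no sign of this kind.\<close>

lemma up_pow_down_pow_delta:
  assumes "is_partition \<alpha>" "is_partition \<beta>"
  shows "(up ^^ n) ((down ^^ m) (delta \<beta>)) (cells \<alpha>) = (-1) ^ v \<beta> * lower_sum \<alpha> \<beta> m n"
proof -
  let ?P = "\<lambda>M. M \<subseteq> cells \<beta> \<and> card (cells \<beta> - M) = m \<and> M \<subseteq> cells \<alpha> \<and> card (cells \<alpha> - M) = n"
  let ?I = diagram_imbalance
  have down: "(down ^^ m) (delta \<beta>) M =
      (if M \<subseteq> cells \<beta> \<and> card (cells \<beta> - M) = m
       then (-1) ^ (v \<beta> + even_rows M) * ?I (cells \<beta>) M else 0)" if "young M" for M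
    using young_cells[OF assms(2)]
    by (simp add: down_pow_eq[OF that] if_distrib[of "\<lambda>x. _ * x"] finite_diagrams_above[OF that]
        cong: if_cong) (auto simp: diagrams_above_def v_eq_even_rows)
  have "(up ^^ n) ((down ^^ m) (delta \<beta>)) (cells \<alpha>) =
      (\<Sum>M \<in> diagrams_below (cells \<alpha>) n. if M \<subseteq> cells \<beta> \<and> card (cells \<beta> - M) = m
         then (-1) ^ (v \<beta> + even_rows M) * ?I (cells \<beta>) M * ?I (cells \<alpha>) M else 0)"
    unfolding up_pow_eq[OF young_cells[OF assms(1)]]
    by (rule sum.cong) (auto simp: down diagrams_below_def)
  also have "\<dots> = (\<Sum>M \<in> {M \<in> diagrams_below (cells \<alpha>) n. M \<subseteq> cells \<beta> \<and> card (cells \<beta> - M) = m}.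
      (-1) ^ (v \<beta> + even_rows M) * ?I (cells \<beta>) M * ?I (cells \<alpha>) M)"
    by (rule sum.inter_filter[symmetric]) (rule finite_diagrams_below[OF young_cells[OF assms(1)]])
  also have "{M \<in> diagrams_below (cells \<alpha>) n. M \<subseteq> cells \<beta> \<and> card (cells \<beta> - M) = m} =
      cells ` {\<mu>. is_partition \<mu> \<and> ?P (cells \<mu>)}"
    unfolding cells_image_Collect[of ?P] by (auto simp: diagrams_below_def)
  also have "(\<Sum>M \<in> \<dots>. (-1) ^ (v \<beta> + even_rows M) * ?I (cells \<beta>) M * ?I (cells \<alpha>) M) =
      (\<Sum>\<mu> \<in> {\<mu>. is_partition \<mu> \<and> ?P (cells \<mu>)}.
        (-1) ^ (v \<beta> + v \<mu>) * ?I (cells \<beta>) (cells \<mu>) * ?I (cells \<alpha>) (cells \<mu>))"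
    by (simp add: sum.reindex[OF inj_on_cells] v_eq_even_rows)
  also have "\<dots> = (-1) ^ v \<beta> * lower_sum \<alpha> \<beta> m n"
    unfolding lower_sum_def sum_distrib_left
    by (rule sum.cong) (auto simp: skew_of_size_int imbalance_eq_diagram_imbalance power_add)
  finally show ?thesis .
qed

theorem theorem5p8:
  fixes \<alpha> \<beta> :: "nat list" and n m :: nat
  assumes "is_partition \<alpha>" and "is_partition \<beta>"
  shows "(-1) ^ (v \<alpha> + v \<beta>) *
      (\<Sum>\<kappa> \<in> {\<kappa>. is_partition \<kappa> \<and> skew_of_size \<kappa> \<alpha> (int m) \<and> skew_of_size \<kappa> \<beta> (int n)}.
         (-1) ^ v \<kappa> * imbalance \<kappa> \<alpha> * imbalance \<kappa> \<beta>) =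
    (-1) ^ (m * n) *
      (\<Sum>\<mu> \<in> {\<mu>. is_partition \<mu> \<and> skew_of_size \<beta> \<mu> (int m) \<and> skew_of_size \<alpha> \<mu> (int n)}.
         (-1) ^ v \<mu> * imbalance \<beta> \<mu> * imbalance \<alpha> \<mu>) +
    ((1 - (-1) ^ (m * n)) div 2) *
      (\<Sum>\<mu> \<in> {\<mu>. is_partition \<mu> \<and> skew_of_size \<beta> \<mu> (int m - 1) \<and> skew_of_size \<alpha> \<mu> (int n - 1)}.
         (-1) ^ v \<mu> * imbalance \<beta> \<mu> * imbalance \<alpha> \<mu>)"
proof -
  have sq: "(-1) ^ k * ((-1) ^ k * x) = x" for k and x :: int
    by (simp flip: mult.assoc power_mult_distrib)
  have delta: "on_diagrams (delta \<beta>)"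
    using young_cells[OF assms(2)] by (auto simp: on_diagrams_def)
  note DU = down_pow_up_pow_delta[OF assms] and UD = up_pow_down_pow_delta[OF assms]
  show ?thesis
  proof (cases "even m \<or> even n")
    \<comment> \<open>As \<open>m * n\<close> is even, the coefficient of the last sum is
      \<open>0\<close>, whatever its sizes are.\<close>
    case True
    have "(-1) ^ v \<alpha> * upper_sum \<alpha> \<beta> m n = (-1) ^ v \<beta> * lower_sum \<alpha> \<beta> m n"
      using down_pow_up_pow_commute[OF True delta] DU UD by metis
    then have "(-1) ^ (v \<alpha> + v \<beta>) * upper_sum \<alpha> \<beta> m n = lower_sum \<alpha> \<beta> m n"
      by (simp add: power_add mult.assoc mult.left_commute[of "(-1) ^ v \<alpha>"] sq)
    then show ?thesis
      using True by (auto simp: upper_sum_def lower_sum_def)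
  next
    case False
    then have odd: "odd m" "odd n" by auto
    \<comment> \<open>Odd numbers are positive, so the integer sizes agree with truncated
      subtraction.\<close>
    then have sub: "int m - 1 = int (m - 1)" "int n - 1 = int (n - 1)"
      by (auto simp: of_nat_diff Suc_le_eq odd_pos)
    have "(-1) ^ v \<alpha> * upper_sum \<alpha> \<beta> m n =
        (-1) ^ v \<beta> * (lower_sum \<alpha> \<beta> (m - 1) (n - 1) - lower_sum \<alpha> \<beta> m n)"
      unfolding right_diff_distrib DU[symmetric] UD[symmetric] down_pow_up_pow_odd[OF odd delta] ..
    then have "(-1) ^ (v \<alpha> + v \<beta>) * upper_sum \<alpha> \<beta> m n =
        lower_sum \<alpha> \<beta> (m - 1) (n - 1) - lower_sum \<alpha> \<beta> m n"
      by (simp add: power_add mult.assoc mult.left_commute[of "(-1) ^ v \<alpha>"] sq)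
    \<comment> \<open>Now \<open>(-1) ^ (m * n)\<close> is \<open>-1\<close> and the coefficient of
      the last sum is \<open>1\<close>.\<close>
    then show ?thesis
      using odd unfolding sub upper_sum_def lower_sum_def by simp
  qed
qed

end
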